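(* Let $x$ and $y$ be positive real numbers. Let $M$ and $N$ be matroids such that there is a rank-preserving weak map from $M$ to $N$. Then $T(M;x,y)\geq T(N;x,y)$ if and only if $x+y\geq xy$ or $M\cong N$. Moreover, if $M\not\cong N$, then $T(M;x,y)>T(N;x,y)$ if and only if $x+y>xy$.
   Context: All matroids are finite. For matroids $M$ and $N$ with $r(M)=r(N)$, a rank-preserving weak map from $M$ to $N$ is a bijection $\varphi:E(M)\to E(N)$ such that $\varphi^{-1}(I)$ is independent in $M$ whenever $I$ is independent in $N$. The Tutte polynomial of a matroid $M$ with ground set $E$ and rank function $r$ is $T(M;x,y)=\sum_{A\subseteq E}(x-1)^{r(E)-r(A)}(y-1)^{|A|-r(A)}$. *)

theory Defs
  imports Complex_Main
begin

locale matroid =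
  fixes E :: "'a set" and indep :: "'a set \<Rightarrow> bool"
  assumes finite_ground: "finite E"
    and indep_subset_ground: "indep I \<Longrightarrow> I \<subseteq> E"
    and indep_empty: "indep {}"
    and indep_subset: "indep I \<Longrightarrow> J \<subseteq> I \<Longrightarrow> indep J"
    and indep_augment: "indep I \<Longrightarrow> indep J \<Longrightarrow> card I < card J \<Longrightarrow> \<exists>e\<in>J - I. indep (insert e I)"

definition matroid_rank :: "('a set \<Rightarrow> bool) \<Rightarrow> 'a set \<Rightarrow> nat" where
  "matroid_rank indep A = Max (card ` {I. I \<subseteq> A \<and> indep I})"

definition rank_preserving_weak_map ::
  "'a set \<Rightarrow> ('a set \<Rightarrow> bool) \<Rightarrow> 'b set \<Rightarrow> ('b set \<Rightarrow> bool) \<Rightarrow> ('a \<Rightarrow> 'b) \<Rightarrow> bool" where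
  "rank_preserving_weak_map E\<^sub>M indep\<^sub>M E\<^sub>N indep\<^sub>N \<phi> \<longleftrightarrow>
     matroid_rank indep\<^sub>M E\<^sub>M = matroid_rank indep\<^sub>N E\<^sub>N \<and>
     bij_betw \<phi> E\<^sub>M E\<^sub>N \<and>
     (\<forall>I. indep\<^sub>N I \<longrightarrow> indep\<^sub>M (\<phi> -` I \<inter> E\<^sub>M))"

definition matroid_isomorphic ::
  "'a set \<Rightarrow> ('a set \<Rightarrow> bool) \<Rightarrow> 'b set \<Rightarrow> ('b set \<Rightarrow> bool) \<Rightarrow> bool" where
  "matroid_isomorphic E\<^sub>M indep\<^sub>M E\<^sub>N indep\<^sub>N \<longleftrightarrow>
     (\<exists>\<psi>. bij_betw \<psi> E\<^sub>M E\<^sub>N \<and> (\<forall>I\<subseteq>E\<^sub>M. indep\<^sub>M I \<longleftrightarrow> indep\<^sub>N (\<psi> ` I)))"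

text \<open>The truncated subtractions in the exponents are exact, since in a matroid the rank of a
  subset \<open>A\<close> of the ground set is at most both the rank of the ground set and \<open>card A\<close>.\<close>

definition tutte :: "'a set \<Rightarrow> ('a set \<Rightarrow> bool) \<Rightarrow> real \<Rightarrow> real \<Rightarrow> real" where
  "tutte E indep x y =
     (\<Sum>A\<in>Pow E. (x - 1) ^ (matroid_rank indep E - matroid_rank indep A) *
                  (y - 1) ^ (card A - matroid_rank indep A))"

end

theory Submission
  imports Defs
begin

text \<open>If \<open>e\<close> is neither a loop nor a coloop of \<open>N\<close>, then the same holds in \<open>M\<close>, and the weak map
  restricts to rank-preserving weak maps on the deletions and on the contractions of \<open>e\<close>. So by
  deletion-contraction, \<open>T(M) - T(N)\<close> is \<open>x + y - xy\<close> times a nonnegative number, positive if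
  \<open>M \<noteq> N\<close>, as soon as this is known when every element of \<open>N\<close> is a loop or a coloop. In that case
  \<open>T(N) = x\<^sup>r y\<^sup>n\<^sup>-\<^sup>r\<close>, and deletion-contraction in \<open>M\<close> alone produces the factor from the identity
  \<open>x\<^sup>r\<^sup>-\<^sup>1 y\<^sup>n\<^sup>-\<^sup>r + x\<^sup>r y\<^sup>n\<^sup>-\<^sup>r\<^sup>-\<^sup>1 - x\<^sup>r y\<^sup>n\<^sup>-\<^sup>r = x\<^sup>r\<^sup>-\<^sup>1 y\<^sup>n\<^sup>-\<^sup>r\<^sup>-\<^sup>1 (x + y - xy)\<close>.\<close>

section \<open>Single-element minors\<close>

definition deletion :: "('a set \<Rightarrow> bool) \<Rightarrow> 'a \<Rightarrow> 'a set \<Rightarrow> bool" where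
  "deletion indep e I \<longleftrightarrow> e \<notin> I \<and> indep I"

text \<open>This is the usual contraction when \<open>{e}\<close> is independent. For a loop
  \<open>e\<close> of a matroid even the empty set fails the test, so contraction is only formed at
  non-loops.\<close>

definition contraction :: "('a set \<Rightarrow> bool) \<Rightarrow> 'a \<Rightarrow> 'a set \<Rightarrow> bool" where
  "contraction indep e I \<longleftrightarrow> e \<notin> I \<and> indep (insert e I)"

context matroid
begin

section \<open>Rank and extension of independent sets\<close>

lemma finite_indep: "indep I \<Longrightarrow> finite I"
  using finite_ground indep_subset_ground finite_subset by blast

text \<open>The set \<open>A\<close> may be infinite or leave the ground set. Independent sets all
  lie in \<open>Pow E\<close>, so the \<open>Max\<close> defining the rank is still taken over a
  finite set.\<close>

lemma finite_indep_cards: "finite (card ` {I. I \<subseteq> A \<and> indep I})"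
proof -
  have "{I. I \<subseteq> A \<and> indep I} \<subseteq> Pow E"
    using indep_subset_ground by auto
  then show ?thesis
    using finite_ground finite_subset by blast
qed

lemma card_le_rank: "I \<subseteq> A \<Longrightarrow> indep I \<Longrightarrow> card I \<le> matroid_rank indep A"
  unfolding matroid_rank_def using finite_indep_cards by (intro Max_ge) auto

lemma rank_witness:
  obtains I where "I \<subseteq> A" "indep I" "card I = matroid_rank indep A"
proof -
  have "matroid_rank indep A \<in> card ` {I. I \<subseteq> A \<and> indep I}"
    unfolding matroid_rank_def using finite_indep_cards indep_empty by (intro Max_in) auto
  then show ?thesis
    using that by auto
qed

lemma rank_eqI:
  assumes "I \<subseteq> A" "indep I" "\<And>J. J \<subseteq> A \<Longrightarrow> indep J \<Longrightarrow> card J \<le> card I"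
  shows "matroid_rank indep A = card I"
  by (metis assms card_le_rank le_antisym rank_witness)

lemma rank_mono: "A \<subseteq> B \<Longrightarrow> matroid_rank indep A \<le> matroid_rank indep B"
  by (metis card_le_rank order_trans rank_witness)

lemma rank_le_card: "finite A \<Longrightarrow> matroid_rank indep A \<le> card A"
  by (metis card_mono rank_witness)

text \<open>While \<open>I\<close> is smaller than a maximum independent subset of \<open>A\<close>,
  augmentation from that subset enlarges \<open>I\<close> inside \<open>A\<close>; the induction is
  on the missing cardinality.\<close>

lemma extend_to_rank:
  assumes "indep I" "I \<subseteq> A"
  obtains J where "indep J" "I \<subseteq> J" "J \<subseteq> A" "card J = matroid_rank indep A"
  using assms
proof (induction "matroid_rank indep A - card I" arbitrary: I thesis rule: less_induct)
  case less
  show ?case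
  proof (cases "card I = matroid_rank indep A")
    case True
    then show ?thesis
      using less.prems by blast
  next
    case False
    then have lt: "card I < matroid_rank indep A"
      using card_le_rank less.prems by (meson le_neq_implies_less)
    obtain B where B: "B \<subseteq> A" "indep B" "card B = matroid_rank indep A"
      by (rule rank_witness)
    obtain b where b: "b \<in> B - I" "indep (insert b I)"
      using indep_augment[of I B] lt B less.prems by auto
    have "card (insert b I) = Suc (card I)"
      using b finite_indep less.prems by simp
    then have "matroid_rank indep A - card (insert b I) < matroid_rank indep A - card I"
      using lt by simp
    then show ?thesis
      using less.hyps[of "insert b I"] less.prems b B by (metis Diff_iff insert_subset subsetD)
  qed
qed

text \<open>The rank drop says that \<open>e\<close> is a coloop. A set \<open>I\<close> avoiding
  \<open>e\<close> extends to a maximum independent subset \<open>J\<close> of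
  \<open>E - {e}\<close>, which is smaller than a basis of \<open>E\<close>. Augmenting
  \<open>J\<close> from that basis can only add \<open>e\<close>, since \<open>J\<close> is already
  maximum without it.\<close>

lemma indep_insert_coloop:
  assumes e: "e \<in> E" "matroid_rank indep (E - {e}) < matroid_rank indep E" and I: "indep I"
  shows "indep (insert e I)"
proof (cases "e \<in> I")
  case True
  then show ?thesis
    using I by (simp add: insert_absorb)
next
  case False
  then have "I \<subseteq> E - {e}"
    using I indep_subset_ground by auto
  then obtain J where J: "indep J" "I \<subseteq> J" "J \<subseteq> E - {e}"
      "card J = matroid_rank indep (E - {e})"
    using I extend_to_rank by metis
  obtain B where B: "B \<subseteq> E" "indep B" "card B = matroid_rank indep E"
    by (rule rank_witness)
  obtain b where b: "b \<in> B - J" "indep (insert b J)"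
    using indep_augment[of J B] J B e by auto
  have "b = e"
  proof (rule ccontr)
    assume "b \<noteq> e"
    then have "card (insert b J) \<le> matroid_rank indep (E - {e})"
      using b B J by (intro card_le_rank) auto
    then show False
      using b J finite_indep by simp
  qed
  then show ?thesis
    using b J indep_subset by (metis insert_mono)
qed

section \<open>Axioms, ranks and Tutte sums of minors\<close>

lemma matroid_deletion: "matroid (E - {e}) (deletion indep e)"
proof
  fix I J assume "deletion indep e I" "deletion indep e J" "card I < card J"
  then show "\<exists>f\<in>J - I. deletion indep e (insert f I)"
    using indep_augment[of I J] unfolding deletion_def by auto
qed (use finite_ground indep_subset_ground indep_empty indep_subset in
      \<open>auto simp: deletion_def\<close>)

lemma matroid_contraction:
  assumes "indep {e}"
  shows "matroid (E - {e}) (contraction indep e)"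
proof
  fix I J assume IJ: "contraction indep e I" "contraction indep e J" "card I < card J"
  then have "card (insert e I) < card (insert e J)"
    unfolding contraction_def by (metis card_insert_disjoint finite_indep finite_insert Suc_less_eq)
  then obtain f where "f \<in> insert e J - insert e I" "indep (insert f (insert e I))"
    using indep_augment IJ unfolding contraction_def by blast
  then show "\<exists>f\<in>J - I. contraction indep e (insert f I)"
    using IJ unfolding contraction_def by (intro bexI[of _ f]) (auto simp: insert_commute)
next
  fix I J assume "contraction indep e I" "J \<subseteq> I"
  then show "contraction indep e J"
    unfolding contraction_def using indep_subset[of "insert e I" "insert e J"] by auto
qed (use assms finite_ground indep_subset_ground in \<open>auto simp: contraction_def\<close>)

lemma rank_deletion:
  assumes "e \<notin> A"
  shows "matroid_rank (deletion indep e) A = matroid_rank indep A"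
proof -
  have "{I. I \<subseteq> A \<and> deletion indep e I} = {I. I \<subseteq> A \<and> indep I}"
    using assms by (auto simp: deletion_def)
  then show ?thesis
    unfolding matroid_rank_def by simp
qed

text \<open>Extending \<open>{e}\<close> gives a maximum independent subset of
  \<open>insert e A\<close> that contains \<open>e\<close>. Removing \<open>e\<close> from it, and
  adding \<open>e\<close> to a maximum independent set of the contraction, give the two
  inequalities.\<close>

lemma rank_contraction:
  assumes "indep {e}" "e \<notin> A"
  shows "matroid_rank indep (insert e A) = Suc (matroid_rank (contraction indep e) A)"
proof -
  interpret C: matroid "E - {e}" "contraction indep e"
    using assms(1) by (rule matroid_contraction)
  obtain J where J: "indep J" "{e} \<subseteq> J" "J \<subseteq> insert e A"
      "card J = matroid_rank indep (insert e A)"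
    using extend_to_rank[OF assms(1), of "insert e A"] by auto
  obtain K where K: "K \<subseteq> A" "contraction indep e K"
      "card K = matroid_rank (contraction indep e) A"
    by (rule C.rank_witness)
  have "card (J - {e}) \<le> matroid_rank (contraction indep e) A"
    using J by (intro C.card_le_rank) (auto simp: contraction_def insert_absorb)
  moreover have "card J = Suc (card (J - {e}))"
    using J finite_indep by (metis card_Suc_Diff1 insert_subset)
  moreover have "card (insert e K) \<le> matroid_rank indep (insert e A)"
    using K by (intro card_le_rank) (auto simp: contraction_def)
  moreover have "card (insert e K) = Suc (card K)"
    using K C.finite_indep by (simp add: contraction_def)
  ultimately show ?thesis
    using J K by simp
qed

text \<open>The sum splits by whether a subset contains \<open>e\<close>. Subsets without
  \<open>e\<close> give the deletion, because the total rank is unchanged. For subsets with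
  \<open>e\<close>, the cardinality, the rank and the total rank all exceed those in the contraction
  by one, so both exponents agree.\<close>

lemma tutte_deletion_contraction:
  assumes e: "e \<in> E" "indep {e}" "matroid_rank indep (E - {e}) = matroid_rank indep E"
  shows "tutte E indep x y =
    tutte (E - {e}) (deletion indep e) x y + tutte (E - {e}) (contraction indep e) x y"
proof -
  define g where "g A = (x - 1) ^ (matroid_rank indep E - matroid_rank indep A) *
                  (y - 1) ^ (card A - matroid_rank indep A)" for A
  define D where "D = E - {e}"
  have D: "E = insert e D" "e \<notin> D" "finite D"
    using e finite_ground by (auto simp: D_def)
  have "tutte E indep x y = sum g (Pow D \<union> insert e ` Pow D)"
    unfolding tutte_def g_def D(1) Pow_insert ..
  also have "\<dots> = sum g (Pow D) + sum g (insert e ` Pow D)"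
    using D by (intro sum.union_disjoint) auto
  also have "sum g (insert e ` Pow D) = (\<Sum>A\<in>Pow D. g (insert e A))"
    using D by (subst sum.reindex) (auto simp: inj_on_def)
  also have "sum g (Pow D) = tutte D (deletion indep e) x y"
    unfolding tutte_def g_def
  proof (intro sum.cong refl)
    fix A assume "A \<in> Pow D"
    then have "e \<notin> A"
      using D by auto
    then show "(x - 1) ^ (matroid_rank indep E - matroid_rank indep A) *
        (y - 1) ^ (card A - matroid_rank indep A) =
      (x - 1) ^ (matroid_rank (deletion indep e) D - matroid_rank (deletion indep e) A) *
        (y - 1) ^ (card A - matroid_rank (deletion indep e) A)"
      using e(3) D(2) by (simp add: rank_deletion flip: D_def)
  qed
  also have "(\<Sum>A\<in>Pow D. g (insert e A)) = tutte D (contraction indep e) x y"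
    unfolding tutte_def g_def
  proof (intro sum.cong refl)
    fix A assume "A \<in> Pow D"
    then have A: "e \<notin> A" "finite A"
      using D finite_subset by auto
    have "matroid_rank indep E = Suc (matroid_rank (contraction indep e) D)"
      using rank_contraction[OF e(2) D(2)] by (simp flip: D(1))
    then show "(x - 1) ^ (matroid_rank indep E - matroid_rank indep (insert e A)) *
        (y - 1) ^ (card (insert e A) - matroid_rank indep (insert e A)) =
      (x - 1) ^ (matroid_rank (contraction indep e) D - matroid_rank (contraction indep e) A) *
        (y - 1) ^ (card A - matroid_rank (contraction indep e) A)"
      using e(2) A by (simp add: rank_contraction)
  qed
  finally show ?thesis
    unfolding D_def .
qed

section \<open>Matroids in which every element is a loop or a coloop\<close>

lemma indep_iff_contains_no_loop:
  assumes "\<And>e. e \<in> E \<Longrightarrow> indep {e} \<Longrightarrow> matroid_rank indep (E - {e}) < matroid_rank indep E"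
  shows "indep I \<longleftrightarrow> I \<subseteq> {e \<in> E. indep {e}}"
proof
  show "indep I \<Longrightarrow> I \<subseteq> {e \<in> E. indep {e}}"
    using indep_subset indep_subset_ground by blast
next
  assume I: "I \<subseteq> {e \<in> E. indep {e}}"
  then have "finite I"
    using finite_ground by (metis (no_types, lifting) finite_subset mem_Collect_eq subsetI)
  then show "indep I"
    using I
  proof induction
    case empty
    show ?case
      by (rule indep_empty)
  next
    \<comment> \<open>Every non-loop is a coloop here, so it can be added to any independent
      set.\<close>
    case (insert e I)
    then show ?case
      using assms indep_insert_coloop by auto
  qed
qed

lemma tutte_loops_coloops:
  assumes "\<And>e. e \<in> E \<Longrightarrow> indep {e} \<Longrightarrow> matroid_rank indep (E - {e}) < matroid_rank indep E"
  shows "tutte E indep x y =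
    x ^ matroid_rank indep E * y ^ (card E - matroid_rank indep E)"
proof -
  define C where "C = {e \<in> E. indep {e}}"
  have C: "C \<subseteq> E" "finite C"
    using finite_ground by (auto simp: C_def)
  have indep: "indep I \<longleftrightarrow> I \<subseteq> C" for I
    using assms indep_iff_contains_no_loop unfolding C_def by blast
  have rank: "matroid_rank indep A = card (A \<inter> C)" for A
    using C by (intro rank_eqI) (auto simp: indep intro: card_mono)
  \<comment> \<open>Since the rank counts the elements of \<open>C\<close>, a summand has a factor
    \<open>y - 1\<close> for each loop in \<open>A\<close> and \<open>x - 1\<close> for each coloop
    outside \<open>A\<close>. The sum over all \<open>A\<close> is then an expanded product, with
    one factor \<open>x\<close> per coloop and \<open>y\<close> per loop.\<close>
  have "tutte E indep x y = (\<Sum>A\<in>Pow E.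
      (\<Prod>e\<in>A. if e \<in> C then 1 else y - 1) * (\<Prod>e\<in>E - A. if e \<in> C then x - 1 else 1))"
    unfolding tutte_def
  proof (intro sum.cong refl)
    fix A assume "A \<in> Pow E"
    then have A: "A \<subseteq> E" "finite A"
      using finite_ground finite_subset by auto
    have "(\<Prod>e\<in>A. if e \<in> C then 1 else y - 1) = (y - 1) ^ card (A - C)"
      using A by (simp add: prod.If_cases Diff_eq)
    moreover have "(\<Prod>e\<in>E - A. if e \<in> C then x - 1 else 1) = (x - 1) ^ card ((E - A) \<inter> C)"
      using finite_ground by (simp add: prod.If_cases)
    moreover have "(E - A) \<inter> C = C - A \<inter> C" "A - C = A - A \<inter> C" "E \<inter> C = C"
      using C by auto
    ultimately show "(x - 1) ^ (matroid_rank indep E - matroid_rank indep A) *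
        (y - 1) ^ (card A - matroid_rank indep A) =
      (\<Prod>e\<in>A. if e \<in> C then 1 else y - 1) * (\<Prod>e\<in>E - A. if e \<in> C then x - 1 else 1)"
      using A C by (simp add: rank card_Diff_subset)
  qed
  also have "\<dots> = (\<Prod>e\<in>E. (if e \<in> C then 1 else y - 1) + (if e \<in> C then x - 1 else 1))"
    using finite_ground by (simp add: prod_add)
  also have "\<dots> = (\<Prod>e\<in>E. if e \<in> C then x else y)"
    by (intro prod.cong) auto
  also have "\<dots> = x ^ card (E \<inter> C) * y ^ card (E - C)"
    using finite_ground by (simp add: prod.If_cases Diff_eq)
  also have "\<dots> = x ^ matroid_rank indep E * y ^ (card E - matroid_rank indep E)"
    using C by (simp add: rank card_Diff_subset Int_absorb1)
  finally show ?thesis .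
qed

end

section \<open>Comparison of Tutte polynomials on one ground set\<close>

text \<open>The monomial is the Tutte polynomial of loops and coloops with the same rank and size.
  Naming the cofactor \<open>p\<close> keeps the statement meaningful where
  \<open>x + y - x * y\<close> vanishes and lets the induction add cofactors.\<close>

lemma tutte_diff_monomial:
  assumes "matroid E indep" and "x > 0" and "y > 0"
  shows "\<exists>p\<ge>0. tutte E indep x y - x ^ matroid_rank indep E * y ^ (card E - matroid_rank indep E) =
      (x + y - x * y) * p \<and>
    ((\<exists>e\<in>E. indep {e} \<and> matroid_rank indep (E - {e}) = matroid_rank indep E) \<longrightarrow> p > 0)"
  using assms(1)
proof (induction "card E" arbitrary: E indep)
  case 0
  then interpret matroid E indep
    by simp
  have "E = {}"
    using 0 finite_ground by simp
  then show ?case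
    using tutte_loops_coloops[of x y] by (intro exI[of _ 0]) auto
next
  case (Suc n)
  interpret matroid E indep
    by fact
  show ?case
  proof (cases "\<exists>e\<in>E. indep {e} \<and> matroid_rank indep (E - {e}) = matroid_rank indep E")
    case False
    then have "matroid_rank indep (E - {e}) < matroid_rank indep E" if "e \<in> E" "indep {e}" for e
      using that rank_mono[of "E - {e}" E] by (metis Diff_subset le_neq_implies_less)
    then show ?thesis
      using tutte_loops_coloops[of x y] False by (intro exI[of _ 0]) auto
  next
    case True
    then obtain e where e: "e \<in> E" "indep {e}" "matroid_rank indep (E - {e}) = matroid_rank indep E"
      by blast
    let ?D = "E - {e}"
    have card: "card ?D = n" "card E = Suc n"
      using Suc.hyps(2) e by auto
    define r where "r = matroid_rank (contraction indep e) ?D"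
    have r: "matroid_rank indep E = Suc r"
      using rank_contraction[of e ?D] e by (simp add: r_def insert_absorb)
    \<comment> \<open>As \<open>e\<close> is not a coloop, the full rank \<open>Suc r\<close> is
      attained within the \<open>n\<close> other elements. With \<open>m\<close> the nullity of the
      deletion, the contraction has rank \<open>r\<close> and nullity \<open>Suc m\<close>, and the
      whole matroid has rank \<open>Suc r\<close> and nullity \<open>Suc m\<close>.\<close>
    have "Suc r \<le> n"
      using rank_le_card[of ?D] finite_ground e r card by simp
    then obtain m where m: "n = Suc r + m"
      using le_Suc_ex by blast
    obtain p where p: "p \<ge> 0" "tutte ?D (deletion indep e) x y - x ^ Suc r * y ^ m =
        (x + y - x * y) * p"
      using Suc.hyps(1)[of ?D "deletion indep e"] matroid_deletion card rank_deletion[of e ?D] e r m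
      by auto
    obtain q where q: "q \<ge> 0" "tutte ?D (contraction indep e) x y - x ^ r * y ^ Suc m =
        (x + y - x * y) * q"
      using Suc.hyps(1)[of ?D "contraction indep e"] matroid_contraction card e m
      by (auto simp flip: r_def)
    \<comment> \<open>The last term comes from the two minor monomials minus the monomial for
      \<open>E\<close>; it alone makes the cofactor positive.\<close>
    let ?p = "p + q + x ^ r * y ^ m"
    have "?p > 0"
      using p q assms by (simp add: add_nonneg_pos)
    moreover have "tutte E indep x y - x ^ Suc r * y ^ Suc m = (x + y - x * y) * ?p"
      using p(2) q(2) tutte_deletion_contraction[OF e, of x y] by (simp add: algebra_simps)
    ultimately show ?thesis
      using r card m by (intro exI[of _ ?p]) auto
  qed
qed

text \<open>Here the weak map is the identity, and equality stands in for isomorphism. Equality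
  suits the induction: it can be recovered from equality of both minors.\<close>

lemma tutte_diff_weak_order:
  assumes "matroid E P" "matroid E Q" "\<And>I. Q I \<Longrightarrow> P I" "matroid_rank P E = matroid_rank Q E"
    and "x > 0" "y > 0"
  shows "\<exists>p\<ge>0. tutte E P x y - tutte E Q x y = (x + y - x * y) * p \<and> (P \<noteq> Q \<longrightarrow> p > 0)"
  using assms(1-4)
proof (induction "card E" arbitrary: E P Q rule: less_induct)
  case less
  interpret P: matroid E P by fact
  interpret Q: matroid E Q by fact
  have le: "matroid_rank Q A \<le> matroid_rank P A" for A
    by (metis P.card_le_rank Q.rank_witness less.prems(3))
  show ?case
  proof (cases "\<exists>e\<in>E. Q {e} \<and> matroid_rank Q (E - {e}) = matroid_rank Q E")
    case True
    then obtain e where e: "e \<in> E" "Q {e}" "matroid_rank Q (E - {e}) = matroid_rank Q E"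
      by blast
    let ?D = "E - {e}"
    \<comment> \<open>The rank of \<open>?D\<close> in \<open>P\<close> is at least its rank in
      \<open>Q\<close>, which is already the common full rank.\<close>
    have eP: "P {e}" "matroid_rank P ?D = matroid_rank P E"
      using e less.prems le[of ?D] P.rank_mono[of ?D E] by auto
    have card: "card ?D < card E"
      using e P.finite_ground by (meson card_Diff1_less)
    have "matroid_rank (deletion P e) ?D = matroid_rank (deletion Q e) ?D"
      using P.rank_deletion[of e ?D] Q.rank_deletion[of e ?D] e eP less.prems by simp
    then obtain p where p: "p \<ge> 0" "tutte ?D (deletion P e) x y - tutte ?D (deletion Q e) x y =
        (x + y - x * y) * p" "deletion P e \<noteq> deletion Q e \<Longrightarrow> p > 0"
      using less.hyps[OF card P.matroid_deletion Q.matroid_deletion] less.prems(3)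
      by (auto simp: deletion_def)
    have "matroid_rank (contraction P e) ?D = matroid_rank (contraction Q e) ?D"
      using P.rank_contraction[of e ?D] Q.rank_contraction[of e ?D] e eP less.prems
      by (simp add: insert_absorb)
    then obtain q where q: "q \<ge> 0"
      "tutte ?D (contraction P e) x y - tutte ?D (contraction Q e) x y = (x + y - x * y) * q"
      "contraction P e \<noteq> contraction Q e \<Longrightarrow> q > 0"
      using less.hyps[OF card P.matroid_contraction[OF eP(1)] Q.matroid_contraction[OF e(2)]]
        less.prems(3)
      by (auto simp: contraction_def)
    \<comment> \<open>Sets avoiding \<open>e\<close> are tested by the deletion, sets containing it
      by the contraction. Hence if \<open>P\<close> and \<open>Q\<close> differ, so does one pair of
      minors, and \<open>p\<close> or \<open>q\<close> is positive.\<close>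
    have "P = Q" if "deletion P e = deletion Q e" "contraction P e = contraction Q e"
    proof
      fix I
      show "P I = Q I"
      proof (cases "e \<in> I")
        case True
        then show ?thesis
          using fun_cong[OF that(2), of "I - {e}"] by (simp add: contraction_def insert_absorb)
      next
        case False
        then show ?thesis
          using fun_cong[OF that(1), of I] by (simp add: deletion_def)
      qed
    qed
    then have "P \<noteq> Q \<Longrightarrow> p + q > 0"
      using p q by (meson add_nonneg_pos add_pos_nonneg)
    moreover have "tutte E P x y - tutte E Q x y = (x + y - x * y) * (p + q)"
      using p(2) q(2) P.tutte_deletion_contraction[OF e(1) eP, of x y]
        Q.tutte_deletion_contraction[OF e, of x y] by (simp add: algebra_simps)
    ultimately show ?thesis
      using p q by (intro exI[of _ "p + q"]) auto
  next
    case False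
    then have coloop: "matroid_rank Q (E - {e}) < matroid_rank Q E" if "e \<in> E" "Q {e}" for e
      using that Q.rank_mono[of "E - {e}" E] by (metis Diff_subset le_neq_implies_less)
    \<comment> \<open>Now \<open>Q\<close> has only loops and coloops, so its Tutte polynomial is
      the monomial with which \<open>P\<close> is compared.\<close>
    obtain p where p: "p \<ge> 0"
      "tutte E P x y - x ^ matroid_rank P E * y ^ (card E - matroid_rank P E) =
        (x + y - x * y) * p"
      "\<exists>e\<in>E. P {e} \<and> matroid_rank P (E - {e}) = matroid_rank P E \<Longrightarrow> p > 0"
      using tutte_diff_monomial[OF less.prems(1) assms(5,6)] by blast
    \<comment> \<open>A coloop of \<open>P\<close> is a coloop of \<open>Q\<close>, because ranks in
      \<open>Q\<close> are no larger and the full ranks agree. So if \<open>P\<close> too has only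
      loops and coloops, both have the same non-loops, which determine them.\<close>
    have "P = Q" if none: "\<not> (\<exists>e\<in>E. P {e} \<and> matroid_rank P (E - {e}) = matroid_rank P E)"
    proof -
      have coloopP: "matroid_rank P (E - {e}) < matroid_rank P E" if "e \<in> E" "P {e}" for e
        using that none P.rank_mono[of "E - {e}" E] by (metis Diff_subset le_neq_implies_less)
      have "Q {e}" if "e \<in> E" "P {e}" for e
      proof -
        have "matroid_rank Q (E - {e}) < matroid_rank Q E"
          using coloopP[OF that] le[of "E - {e}"] less.prems(4) by simp
        then show ?thesis
          using Q.indep_insert_coloop Q.indep_empty that by blast
      qed
      then have "{e \<in> E. P {e}} = {e \<in> E. Q {e}}"
        using less.prems(3) by blast
      then show ?thesis
        by (intro ext trans[OF P.indep_iff_contains_no_loop[OF coloopP]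
              trans[OF _ Q.indep_iff_contains_no_loop[OF coloop, symmetric]]]) simp_all
    qed
    then show ?thesis
      using p Q.tutte_loops_coloops[OF coloop, of x y] less.prems(4)
      by (intro exI[of _ p]) auto
  qed
qed

section \<open>Transport along bijections\<close>

lemma rank_isomorphism:
  assumes "bij_betw \<psi> E F" "\<And>I. I \<subseteq> E \<Longrightarrow> P I \<longleftrightarrow> Q (\<psi> ` I)" "A \<subseteq> E"
  shows "matroid_rank P A = matroid_rank Q (\<psi> ` A)"
proof -
  have inj: "inj_on \<psi> E"
    using assms(1) by (rule bij_betw_imp_inj_on)
  have "card ` {I. I \<subseteq> A \<and> P I} = (\<lambda>I. card (\<psi> ` I)) ` {I. I \<subseteq> A \<and> P I}"
    using assms(3) inj by (intro image_cong refl) (metis card_image inj_on_subset mem_Collect_eq)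
  also have "\<dots> = card ` ((`) \<psi> ` {I. I \<subseteq> A \<and> P I})"
    by (simp add: image_image)
  also have "(`) \<psi> ` {I. I \<subseteq> A \<and> P I} = {J. J \<subseteq> \<psi> ` A \<and> Q J}"
  proof (intro subset_antisym subsetI)
    fix J assume "J \<in> {J. J \<subseteq> \<psi> ` A \<and> Q J}"
    then obtain I where "I \<subseteq> A" "J = \<psi> ` I" "Q J"
      by (auto simp: subset_image_iff)
    then show "J \<in> (`) \<psi> ` {I. I \<subseteq> A \<and> P I}"
      using assms(2)[of I] assms(3) by auto
  next
    fix J assume "J \<in> (`) \<psi> ` {I. I \<subseteq> A \<and> P I}"
    then obtain I where "I \<subseteq> A" "J = \<psi> ` I" "P I"
      by auto
    then show "J \<in> {J. J \<subseteq> \<psi> ` A \<and> Q J}"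
      using assms(2)[of I] assms(3) by auto
  qed
  finally show ?thesis
    unfolding matroid_rank_def by simp
qed

lemma tutte_isomorphism:
  assumes "bij_betw \<psi> E F" "\<And>I. I \<subseteq> E \<Longrightarrow> P I \<longleftrightarrow> Q (\<psi> ` I)"
  shows "tutte E P x y = tutte F Q x y"
proof -
  have F: "F = \<psi> ` E" and inj: "inj_on \<psi> E"
    using assms(1) by (auto simp: bij_betw_def)
  have rank: "A \<subseteq> E \<Longrightarrow> matroid_rank P A = matroid_rank Q (\<psi> ` A)" for A
    using rank_isomorphism[where P = P and Q = Q, OF assms] .
  have "tutte F Q x y = (\<Sum>A\<in>Pow E. (x - 1) ^ (matroid_rank Q F - matroid_rank Q (\<psi> ` A)) *
      (y - 1) ^ (card (\<psi> ` A) - matroid_rank Q (\<psi> ` A)))"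
    unfolding tutte_def using bij_betw_Pow[OF assms(1)]
    by (rule sum.reindex_bij_betw[symmetric])
  also have "\<dots> = tutte E P x y"
    unfolding tutte_def
    using inj by (intro sum.cong refl) (simp add: rank F card_image inj_on_subset)
  finally show ?thesis ..
qed

text \<open>This moves the target of a weak map onto the ground set of its source. The conjunct
  \<open>I \<subseteq> E\<close> excludes sets with points outside \<open>E\<close> whose images
  happen to be independent.\<close>

lemma matroid_pullback:
  assumes "matroid F Q" "bij_betw \<phi> E F"
  shows "matroid E (\<lambda>I. I \<subseteq> E \<and> Q (\<phi> ` I))"
proof -
  interpret Q: matroid F Q by fact
  have inj: "inj_on \<phi> E"
    using assms(2) by (rule bij_betw_imp_inj_on)
  show ?thesis
  proof
    show "finite E"
      using assms(2) Q.finite_ground bij_betw_finite by blast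
  next
    fix I J assume IJ: "I \<subseteq> E \<and> Q (\<phi> ` I)" "J \<subseteq> E \<and> Q (\<phi> ` J)" "card I < card J"
    then have "card (\<phi> ` I) < card (\<phi> ` J)"
      using inj by (metis card_image inj_on_subset)
    then obtain e where "e \<in> J" "\<phi> e \<notin> \<phi> ` I" "Q (insert (\<phi> e) (\<phi> ` I))"
      using Q.indep_augment IJ by blast
    then show "\<exists>e\<in>J - I. insert e I \<subseteq> E \<and> Q (\<phi> ` insert e I)"
      using IJ by (intro bexI[of _ e]) auto
  next
    fix I J assume "I \<subseteq> E \<and> Q (\<phi> ` I)" "J \<subseteq> I"
    then show "J \<subseteq> E \<and> Q (\<phi> ` J)"
      using Q.indep_subset by (meson image_mono order_trans)
  qed (use Q.indep_empty in auto)
qed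

theorem theorem2:
  fixes x y :: real
    and E\<^sub>M :: "'a set" and indep\<^sub>M :: "'a set \<Rightarrow> bool"
    and E\<^sub>N :: "'b set" and indep\<^sub>N :: "'b set \<Rightarrow> bool"
  assumes "x > 0" and "y > 0"
    and "matroid E\<^sub>M indep\<^sub>M" and "matroid E\<^sub>N indep\<^sub>N"
    and "\<exists>\<phi>. rank_preserving_weak_map E\<^sub>M indep\<^sub>M E\<^sub>N indep\<^sub>N \<phi>"
  shows "(tutte E\<^sub>M indep\<^sub>M x y \<ge> tutte E\<^sub>N indep\<^sub>N x y \<longleftrightarrow>
            x + y \<ge> x * y \<or> matroid_isomorphic E\<^sub>M indep\<^sub>M E\<^sub>N indep\<^sub>N) \<and>
         (\<not> matroid_isomorphic E\<^sub>M indep\<^sub>M E\<^sub>N indep\<^sub>N \<longrightarrow>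
            (tutte E\<^sub>M indep\<^sub>M x y > tutte E\<^sub>N indep\<^sub>N x y \<longleftrightarrow> x + y > x * y))"
proof (cases "matroid_isomorphic E\<^sub>M indep\<^sub>M E\<^sub>N indep\<^sub>N")
  case True
  then obtain \<psi> where \<psi>: "bij_betw \<psi> E\<^sub>M E\<^sub>N"
    "\<And>I. I \<subseteq> E\<^sub>M \<Longrightarrow> indep\<^sub>M I \<longleftrightarrow> indep\<^sub>N (\<psi> ` I)"
    unfolding matroid_isomorphic_def by blast
  have "tutte E\<^sub>M indep\<^sub>M x y = tutte E\<^sub>N indep\<^sub>N x y"
    using \<psi> by (rule tutte_isomorphism)
  then show ?thesis
    using True by simp
next
  case False
  obtain \<phi> where rank: "matroid_rank indep\<^sub>M E\<^sub>M = matroid_rank indep\<^sub>N E\<^sub>N"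
    and bij: "bij_betw \<phi> E\<^sub>M E\<^sub>N"
    and weak: "\<And>I. indep\<^sub>N I \<Longrightarrow> indep\<^sub>M (\<phi> -` I \<inter> E\<^sub>M)"
    using assms(5) unfolding rank_preserving_weak_map_def by blast
  \<comment> \<open>A copy of the second matroid on the ground set of the first, making the weak map
    an inclusion of independent sets.\<close>
  define Q where "Q I \<longleftrightarrow> I \<subseteq> E\<^sub>M \<and> indep\<^sub>N (\<phi> ` I)" for I
  have Q: "matroid E\<^sub>M Q"
    using matroid_pullback[OF assms(4) bij] unfolding Q_def .
  have iso: "I \<subseteq> E\<^sub>M \<Longrightarrow> Q I \<longleftrightarrow> indep\<^sub>N (\<phi> ` I)" for I
    by (simp add: Q_def)
  have "indep\<^sub>M I" if "Q I" for I
  proof -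
    have "\<phi> -` (\<phi> ` I) \<inter> E\<^sub>M = I"
      using that bij by (auto simp: Q_def bij_betw_def inj_on_def)
    then show ?thesis
      using weak[of "\<phi> ` I"] that by (simp add: Q_def)
  qed
  moreover have "matroid_rank indep\<^sub>M E\<^sub>M = matroid_rank Q E\<^sub>M"
    using rank_isomorphism[where P = Q and Q = indep\<^sub>N, OF bij iso, of E\<^sub>M] rank bij by (simp add: bij_betw_def)
  \<comment> \<open>Otherwise \<open>\<phi>\<close> itself would be an isomorphism.\<close>
  moreover have "indep\<^sub>M \<noteq> Q"
    using False bij iso unfolding matroid_isomorphic_def by blast
  ultimately obtain p where "p > 0"
    "tutte E\<^sub>M indep\<^sub>M x y - tutte E\<^sub>M Q x y = (x + y - x * y) * p"
    using tutte_diff_weak_order[OF assms(3) Q _ _ assms(1,2)] by blast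
  moreover have "tutte E\<^sub>M Q x y = tutte E\<^sub>N indep\<^sub>N x y"
    using bij iso by (rule tutte_isomorphism)
  ultimately have diff: "tutte E\<^sub>M indep\<^sub>M x y - tutte E\<^sub>N indep\<^sub>N x y = (x + y - x * y) * p"
    and "p > 0"
    by simp_all
  \<comment> \<open>Since \<open>p > 0\<close>, the difference has the same sign as
    \<open>x + y - x * y\<close>.\<close>
  then have "tutte E\<^sub>M indep\<^sub>M x y - tutte E\<^sub>N indep\<^sub>N x y \<ge> 0 \<longleftrightarrow> x + y - x * y \<ge> 0"
    "tutte E\<^sub>M indep\<^sub>M x y - tutte E\<^sub>N indep\<^sub>N x y > 0 \<longleftrightarrow> x + y - x * y > 0"
    by (simp_all only: diff zero_le_mult_iff zero_less_mult_iff) auto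
  then show ?thesis
    using False by simp
qed

end
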